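(* Let $M$ be a topological space with involution $\tau$ and a base point $k_\ast=\tau(k_\ast)$, and let $A_\ast\in R_{s+1,1}(2n)\simeq R_s(n)$ be the base point of $C_s(n)\simeq C_{s+2}(2n)$ and of $C_{s+1}(2n)$. The assignment that sends a map $g:M\to C_s(n)\simeq C_{s+2}(2n)$, $k\mapsto A_k$, to the map $F:\tilde SM\to C_{s+1}(2n)$, $F(k,t)=\beta_t(A_k)$, induces a map $$\beta_\ast:\;[M,C_s(n)]_\ast\to[\tilde SM,C_{s+1}(2n)]_\ast$$ between homotopy classes of base-point preserving maps, and it descends to a map $$\beta_\ast^{\mathbb{Z}_2}:\;[M,C_s(n)]_\ast^{\mathbb{Z}_2}\to[\tilde SM,C_{s+1}(2n)]_\ast^{\mathbb{Z}_2}$$ between homotopy classes of base-point preserving $\mathbb{Z}_2$-equivariant maps.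
   Context: Let $s\ge0$. $W=\mathbb{C}^{2n}$ carries a Hermitian scalar product $\langle\cdot,\cdot\rangle$ and a non-degenerate symmetric complex bilinear form $\{\cdot,\cdot\}$, related by $\langle\psi,\psi'\rangle=\{\gamma\psi,\psi'\}$ for a complex anti-linear involution $\gamma$ of $W$; $j_1,\dots,j_s$ are $\mathbb{C}$-linear operators on $W$ preserving both forms with $j_lj_m+j_mj_l=-2\delta_{lm}\mathrm{Id}$. For subspaces, $^{\mathrm c}$ denotes the Hermitian orthogonal complement and $^\perp$ the annihilator w.r.t. $\{\cdot,\cdot\}$. $C_s(n)$ is the space of complex subspaces $a\subset W$ with $j_1a=\dots=j_sa=a^{\mathrm c}$, topologized inside the disjoint union of Grassmannians; $R_s(n)=\{a\in C_s(n)\mid a=a^\perp\}$. $\mathbb{C}^2\otimes W=W\oplus W$ carries the orthogonal-sum Hermitian product and bilinear form. Put $J_l=\begin{pmatrix}0&1\\1&0\end{pmatrix}\otimes j_l$, $I=\begin{pmatrix}0&1\\-1&0\end{pmatrix}\otimes\mathrm{Id}_W$, $K=\begin{pmatrix}\mathrm{i}&0\\0&-\mathrm{i}\end{pmatrix}\otimes\mathrm{Id}_W$. $C_{s+1}(2n)$ is the space of complex subspaces $A\subset\mathbb{C}^2\otimes W$ with $J_1A=\dots=J_sA=IA=A^{\mathrm c}$; $C_{s+2}(2n)=\{A\in C_{s+1}(2n)\mid KA=A^{\mathrm c}\}$; $R_{s+1,1}(2n)=\{A\in C_{s+2}(2n)\mid A=A^\perp\}$. The identifications $C_s(n)\simeq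 C_{s+2}(2n)$ and $R_s(n)\simeq R_{s+1,1}(2n)$ are by $a\mapsto\{\binom11\otimes w+\binom1{-1}\otimes w'\mid w\in a,\ w'\in a^{\mathrm c}\}$. The non-trivial element of $\mathbb{Z}_2$ acts on all these spaces by $A\mapsto A^\perp$ and on $M$ by $\tau$. For $A\in C_{s+2}(2n)$, $\beta_t(A)=\mathrm{e}^{(t\pi/2)KJ(A)}\cdot E_{+\mathrm{i}}(K)\in C_{s+1}(2n)$, where $J(A)=\mathrm{i}(\Pi_A-\Pi_{A^{\mathrm c}})$ and $E_{+\mathrm{i}}(K)$ is the $+\mathrm{i}$ eigenspace of $K$. $\tilde SM$ is $M\times[0,1]$ with $M\times\{0\}$ collapsed to one point and $M\times\{1\}$ collapsed to another point, with involution $(k,t)\mapsto(\tau(k),1-t)$ and base point $(k_\ast,1/2)$. $[X,Y]_\ast$ (resp. $[X,Y]_\ast^{\mathbb{Z}_2}$) is the set of homotopy classes, through maps of the same kind, of base-point preserving (resp. base-point preserving and $\mathbb{Z}_2$-equivariant) maps. *)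

theory Defs
  imports "HOL-Analysis.Analysis"
begin

text \<open>
  Both \<open>W\<close> (scalar multiplication \<open>(*s)\<close>) and \<open>W \<oplus> W\<close> (scalar multiplication \<open>dscale\<close>) occur,
  so the notions for subspaces take the scalar multiplication \<open>sc\<close> and the forms as parameters.
\<close>

section \<open>The single-particle space\<close>

text \<open>The Hermitian form \<open>h\<close> is anti-linear in its first and linear in its second argument.\<close>

locale clifford_setting =
  fixes h b :: "complex ^ 'm::finite \<Rightarrow> complex ^ 'm \<Rightarrow> complex"
    and \<gamma> :: "complex ^ 'm \<Rightarrow> complex ^ 'm"
    and s :: nat
    and j :: "nat \<Rightarrow> complex ^ 'm \<Rightarrow> complex ^ 'm"
  assumes h_linear: "Vector_Spaces.linear (*s) (*) (h x)"
    and h_hermitian: "h y x = cnj (h x y)"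
    and h_positive: "x \<noteq> 0 \<Longrightarrow> 0 < Re (h x x)"
    and b_linear: "Vector_Spaces.linear (*s) (*) (b x)"
    and b_symmetric: "b y x = b x y"
    and b_nondegenerate: "(\<And>y. b x y = 0) \<Longrightarrow> x = 0"
    and \<gamma>_add: "\<gamma> (x + y) = \<gamma> x + \<gamma> y"
    and \<gamma>_scale: "\<gamma> (c *s x) = cnj c *s \<gamma> x"
    and \<gamma>_involution: "\<gamma> (\<gamma> x) = x"
    and h_eq_b: "h x y = b (\<gamma> x) y"
    and j_linear: "l \<in> {1..s} \<Longrightarrow> Vector_Spaces.linear (*s) (*s) (j l)"
    and j_preserves_h: "l \<in> {1..s} \<Longrightarrow> h (j l x) (j l y) = h x y"
    and j_preserves_b: "l \<in> {1..s} \<Longrightarrow> b (j l x) (j l y) = b x y"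
    and j_clifford: "l \<in> {1..s} \<Longrightarrow> m \<in> {1..s} \<Longrightarrow>
          j l (j m x) + j m (j l x) = (if l = m then - 2 else 0) *s x"


section \<open>Complements, projections and Grassmannians\<close>

definition hcomp :: "('v \<Rightarrow> 'v \<Rightarrow> complex) \<Rightarrow> 'v set \<Rightarrow> 'v set" where
  "hcomp h a = {v. \<forall>w\<in>a. h w v = 0}"

definition annih :: "('v \<Rightarrow> 'v \<Rightarrow> complex) \<Rightarrow> 'v set \<Rightarrow> 'v set" where
  "annih b a = {v. \<forall>w\<in>a. b w v = 0}"

definition oproj :: "('v::ab_group_add \<Rightarrow> 'v \<Rightarrow> complex) \<Rightarrow> 'v set \<Rightarrow> 'v \<Rightarrow> 'v" where
  "oproj h a v = (THE w. w \<in> a \<and> v - w \<in> hcomp h a)"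

text \<open>
  The disjoint union of the Grassmannians: a subspace is identified with the pair of its
  dimension, in the discrete space \<open>nat\<close>, and its orthogonal projection.  The function type
  carries the topology of pointwise convergence, which on linear operators of a
  finite-dimensional space is the operator norm topology.
\<close>

definition grassmannians ::
  "(complex \<Rightarrow> 'v::{ab_group_add,topological_space} \<Rightarrow> 'v) \<Rightarrow> ('v \<Rightarrow> 'v \<Rightarrow> complex) \<Rightarrow> 'v set topology"
  where
  "grassmannians sc h =
     pullback_topology {a. module.subspace sc a} (\<lambda>a. (vector_space.dim sc a, oproj h a)) euclidean"

text \<open>The space of all complex subspaces \<open>a\<close> with \<open>T a = a\<^sup>c\<close> for every operator \<open>T\<close> in \<open>\<T>\<close>.\<close>

definition Cspace ::
  "(complex \<Rightarrow> 'v::{ab_group_add,topological_space} \<Rightarrow> 'v) \<Rightarrow> ('v \<Rightarrow> 'v \<Rightarrow> complex)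
     \<Rightarrow> ('v \<Rightarrow> 'v) set \<Rightarrow> 'v set topology"
  where
  "Cspace sc h \<T> = subtopology (grassmannians sc h) {a. \<forall>T\<in>\<T>. T ` a = hcomp h a}"


section \<open>The doubled space\<close>

type_synonym 'm dbl = "(complex ^ 'm) \<times> (complex ^ 'm)"

definition dscale :: "complex \<Rightarrow> 'm::finite dbl \<Rightarrow> 'm dbl" where
  "dscale c p = (c *s fst p, c *s snd p)"

definition dform ::
  "(complex ^ 'm::finite \<Rightarrow> complex ^ 'm \<Rightarrow> complex) \<Rightarrow> 'm dbl \<Rightarrow> 'm dbl \<Rightarrow> complex" where
  "dform f p q = f (fst p) (fst q) + f (snd p) (snd q)"

text \<open>\<open>tens p q r t T\<close> is the tensor product of the matrix with rows \<open>(p, q)\<close>, \<open>(r, t)\<close> with \<open>T\<close>.\<close>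

definition tens ::
  "complex \<Rightarrow> complex \<Rightarrow> complex \<Rightarrow> complex \<Rightarrow> (complex ^ 'm::finite \<Rightarrow> complex ^ 'm)
     \<Rightarrow> 'm dbl \<Rightarrow> 'm dbl" where
  "tens p q r t T v = (p *s T (fst v) + q *s T (snd v), r *s T (fst v) + t *s T (snd v))"

definition J_op :: "(nat \<Rightarrow> complex ^ 'm::finite \<Rightarrow> complex ^ 'm) \<Rightarrow> nat \<Rightarrow> 'm dbl \<Rightarrow> 'm dbl" where
  "J_op j l = tens 0 1 1 0 (j l)"

definition I_op :: "'m::finite dbl \<Rightarrow> 'm dbl" where
  "I_op = tens 0 1 (- 1) 0 id"

definition K_op :: "'m::finite dbl \<Rightarrow> 'm dbl" where
  "K_op = tens \<i> 0 0 (- \<i>) id"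


section \<open>The classifying spaces\<close>

definition C_s ::
  "(complex ^ 'm::finite \<Rightarrow> complex ^ 'm \<Rightarrow> complex) \<Rightarrow> nat
     \<Rightarrow> (nat \<Rightarrow> complex ^ 'm \<Rightarrow> complex ^ 'm) \<Rightarrow> (complex ^ 'm) set topology" where
  "C_s h s j = Cspace (*s) h (j ` {1..s})"

definition R_s ::
  "(complex ^ 'm::finite \<Rightarrow> complex ^ 'm \<Rightarrow> complex) \<Rightarrow> (complex ^ 'm \<Rightarrow> complex ^ 'm \<Rightarrow> complex)
     \<Rightarrow> nat \<Rightarrow> (nat \<Rightarrow> complex ^ 'm \<Rightarrow> complex ^ 'm) \<Rightarrow> (complex ^ 'm) set set" where
  "R_s h b s j = {a \<in> topspace (C_s h s j). a = annih b a}"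

text \<open>\<open>C_s1\<close>, \<open>C_s2\<close> and \<open>R_s1_1\<close> are \<open>C\<^sub>s\<^sub>+\<^sub>1(2n)\<close>, \<open>C\<^sub>s\<^sub>+\<^sub>2(2n)\<close> and \<open>R\<^sub>s\<^sub>+\<^sub>1\<^sub>,\<^sub>1(2n)\<close>.\<close>

definition C_s1 ::
  "(complex ^ 'm::finite \<Rightarrow> complex ^ 'm \<Rightarrow> complex) \<Rightarrow> nat
     \<Rightarrow> (nat \<Rightarrow> complex ^ 'm \<Rightarrow> complex ^ 'm) \<Rightarrow> 'm dbl set topology" where
  "C_s1 h s j = Cspace dscale (dform h) (insert I_op (J_op j ` {1..s}))"

definition C_s2 ::
  "(complex ^ 'm::finite \<Rightarrow> complex ^ 'm \<Rightarrow> complex) \<Rightarrow> nat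
     \<Rightarrow> (nat \<Rightarrow> complex ^ 'm \<Rightarrow> complex ^ 'm) \<Rightarrow> 'm dbl set topology" where
  "C_s2 h s j = subtopology (C_s1 h s j) {A. K_op ` A = hcomp (dform h) A}"

definition R_s1_1 ::
  "(complex ^ 'm::finite \<Rightarrow> complex ^ 'm \<Rightarrow> complex) \<Rightarrow> (complex ^ 'm \<Rightarrow> complex ^ 'm \<Rightarrow> complex)
     \<Rightarrow> nat \<Rightarrow> (nat \<Rightarrow> complex ^ 'm \<Rightarrow> complex ^ 'm) \<Rightarrow> 'm dbl set set" where
  "R_s1_1 h b s j = {A \<in> topspace (C_s2 h s j). A = annih (dform b) A}"

text \<open>The identification of \<open>C\<^sub>s(n)\<close> with \<open>C\<^sub>s\<^sub>+\<^sub>2(2n)\<close>; here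
  \<open>(1,1)\<^sup>t \<otimes> w + (1,-1)\<^sup>t \<otimes> w' = (w + w', w - w')\<close>.\<close>

definition dbl_sub ::
  "(complex ^ 'm::finite \<Rightarrow> complex ^ 'm \<Rightarrow> complex) \<Rightarrow> (complex ^ 'm) set \<Rightarrow> 'm dbl set" where
  "dbl_sub h a = {(w + w', w - w') | w w'. w \<in> a \<and> w' \<in> hcomp h a}"


section \<open>The Bott map\<close>

definition op_exp :: "('v::real_normed_vector \<Rightarrow> 'v) \<Rightarrow> 'v \<Rightarrow> 'v" where
  "op_exp T v = (\<Sum>k. (T ^^ k) v /\<^sub>R fact k)"

definition J_of ::
  "(complex ^ 'm::finite \<Rightarrow> complex ^ 'm \<Rightarrow> complex) \<Rightarrow> 'm dbl set \<Rightarrow> 'm dbl \<Rightarrow> 'm dbl" where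
  "J_of h A v = dscale \<i> (oproj (dform h) A v - oproj (dform h) (hcomp (dform h) A) v)"

definition E_plus :: "'m::finite dbl set" where
  "E_plus = {v. K_op v = dscale \<i> v}"

definition beta ::
  "(complex ^ 'm::finite \<Rightarrow> complex ^ 'm \<Rightarrow> complex) \<Rightarrow> real \<Rightarrow> 'm dbl set \<Rightarrow> 'm dbl set" where
  "beta h t A = op_exp (\<lambda>v. (t * pi / 2) *\<^sub>R K_op (J_of h A v)) ` E_plus"


section \<open>The suspension with its involution\<close>

text \<open>The points of the suspension are the classes of \<open>M \<times> [0,1]\<close> modulo \<open>susp_rel M\<close>.\<close>

definition susp_rel :: "'k topology \<Rightarrow> (('k \<times> real) \<times> ('k \<times> real)) set" where
  "susp_rel M = {(p, q). p \<in> topspace M \<times> {0..1} \<and> q \<in> topspace M \<times> {0..1} \<and>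
     (p = q \<or> snd p = 0 \<and> snd q = 0 \<or> snd p = 1 \<and> snd q = 1)}"

definition quotient_top :: "'p topology \<Rightarrow> ('p \<times> 'p) set \<Rightarrow> 'p set topology" where
  "quotient_top X R = topology (\<lambda>U. U \<subseteq> topspace X // R \<and> openin X (\<Union>U))"

definition susp :: "'k topology \<Rightarrow> ('k \<times> real) set topology" where
  "susp M = quotient_top (prod_topology M (top_of_set {0..1})) (susp_rel M)"

definition susp_pt :: "'k topology \<Rightarrow> 'k \<Rightarrow> real \<Rightarrow> ('k \<times> real) set" where
  "susp_pt M k t = susp_rel M `` {(k, t)}"

definition susp_inv :: "('k \<Rightarrow> 'k) \<Rightarrow> ('k \<times> real) set \<Rightarrow> ('k \<times> real) set" where
  "susp_inv \<tau> c = (\<lambda>(k, t). (\<tau> k, 1 - t)) ` c"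

text \<open>\<open>bott_map h g\<close> is the map \<open>F\<close> with \<open>F(k,t) = \<beta>\<^sub>t(A\<^sub>k)\<close>, where \<open>A\<^sub>k = dbl_sub h (g k)\<close>.  It is
  meaningful at a class \<open>c\<close> only if the right-hand side is constant on \<open>c\<close>.\<close>

definition bott_map ::
  "(complex ^ 'm::finite \<Rightarrow> complex ^ 'm \<Rightarrow> complex) \<Rightarrow> ('k \<Rightarrow> (complex ^ 'm) set)
     \<Rightarrow> ('k \<times> real) set \<Rightarrow> 'm dbl set" where
  "bott_map h g c = (THE B. \<forall>(k, t) \<in> c. B = beta h t (dbl_sub h (g k)))"

lemma equiv_susp_rel: "equiv (topspace M \<times> {0..1}) (susp_rel M)"
  by (rule equivI) (auto simp: susp_rel_def refl_on_def intro!: symI transI)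

lemma openin_quotient_top:
  assumes "equiv (topspace X) R"
  shows "openin (quotient_top X R) U \<longleftrightarrow> U \<subseteq> topspace X // R \<and> openin X (\<Union>U)"
proof -
  let ?P = "\<lambda>U. U \<subseteq> topspace X // R \<and> openin X (\<Union>U)"
  have "\<Union>(S \<inter> T) = \<Union>S \<inter> \<Union>T" if "S \<subseteq> topspace X // R" "T \<subseteq> topspace X // R" for S T
    using quotient_disj[OF assms] that by blast
  moreover have "openin X (\<Union>(\<Union>\<K>))" if "\<forall>K\<in>\<K>. ?P K" for \<K>
  proof -
    have "\<Union>(\<Union>\<K>) = \<Union>(Union ` \<K>)"
      by blast
    moreover have "openin X (\<Union>(Union ` \<K>))"
      using that by (intro openin_Union) blast
    ultimately show ?thesis
      by simp
  qed
  ultimately have "istopology ?P"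
    unfolding istopology_def by (metis (no_types, lifting) Sup_least inf.coboundedI1 openin_Int)
  then show ?thesis
    by (simp add: quotient_top_def)
qed

lemma topspace_quotient_top:
  assumes "equiv (topspace X) R"
  shows "topspace (quotient_top X R) = topspace X // R"
proof -
  have "openin (quotient_top X R) (topspace X // R)"
    using assms by (simp add: openin_quotient_top Union_quotient)
  then show ?thesis
    using assms by (auto simp: topspace_def openin_quotient_top)
qed

lemma quotient_map_quotient_top:
  assumes "equiv (topspace X) R"
  shows "quotient_map X (quotient_top X R) (\<lambda>x. R `` {x})"
proof -
  have "{x \<in> topspace X. R `` {x} \<in> U} = \<Union>U" if U: "U \<subseteq> topspace X // R" for U
  proof -
    have "R `` {x} = c" if "c \<in> U" "x \<in> c" for x c
      using assms U that by (metis Image_singleton_iff equiv_class_eq quotientE subsetD)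
    moreover have "x \<in> topspace X" if "c \<in> U" "x \<in> c" for x c
      using assms U that Union_quotient by blast
    moreover have "x \<in> R `` {x}" if "x \<in> topspace X" for x
      using assms that equiv_class_self by metis
    ultimately show ?thesis by blast
  qed
  then show ?thesis
    using assms
    by (auto simp: quotient_map_def topspace_quotient_top openin_quotient_top quotient_def)
qed


section \<open>Pointed and equivariant homotopy classes\<close>

definition based :: "'x \<Rightarrow> 'y \<Rightarrow> ('x \<Rightarrow> 'y) \<Rightarrow> bool" where
  "based x0 y0 f \<longleftrightarrow> f x0 = y0"

text \<open>\<open>\<sigma>\<close> and \<open>\<rho>\<close> are the involutions of the source \<open>X\<close> and of the target.\<close>

definition based_equivariant ::
  "'x topology \<Rightarrow> ('x \<Rightarrow> 'x) \<Rightarrow> 'x \<Rightarrow> ('y \<Rightarrow> 'y) \<Rightarrow> 'y \<Rightarrow> ('x \<Rightarrow> 'y) \<Rightarrow> bool" where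
  "based_equivariant X \<sigma> x0 \<rho> y0 f \<longleftrightarrow> f x0 = y0 \<and> (\<forall>x\<in>topspace X. f (\<sigma> x) = \<rho> (f x))"

definition maps_with :: "(('x \<Rightarrow> 'y) \<Rightarrow> bool) \<Rightarrow> 'x topology \<Rightarrow> 'y topology \<Rightarrow> ('x \<Rightarrow> 'y) set" where
  "maps_with P X Y = {f. continuous_map X Y f \<and> P f}"

definition htpy_rel ::
  "(('x \<Rightarrow> 'y) \<Rightarrow> bool) \<Rightarrow> 'x topology \<Rightarrow> 'y topology \<Rightarrow> (('x \<Rightarrow> 'y) \<times> ('x \<Rightarrow> 'y)) set" where
  "htpy_rel P X Y = {(f, g). homotopic_with P X Y f g}"

definition htpy_class ::
  "(('x \<Rightarrow> 'y) \<Rightarrow> bool) \<Rightarrow> 'x topology \<Rightarrow> 'y topology \<Rightarrow> ('x \<Rightarrow> 'y) \<Rightarrow> ('x \<Rightarrow> 'y) set" where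
  "htpy_class P X Y f = htpy_rel P X Y `` {f}"

definition htpy_classes ::
  "(('x \<Rightarrow> 'y) \<Rightarrow> bool) \<Rightarrow> 'x topology \<Rightarrow> 'y topology \<Rightarrow> ('x \<Rightarrow> 'y) set set" where
  "htpy_classes P X Y = maps_with P X Y // htpy_rel P X Y"

text \<open>The assignment \<open>\<Phi>\<close> sends maps of kind \<open>P\<close> to maps of kind \<open>Q\<close> and induces a (then unique)
  map of homotopy classes; \<open>\<rightarrow>\<^sub>E\<close> only fixes its values outside the domain.\<close>

definition induces_on_htpy_classes ::
  "(('x \<Rightarrow> 'y) \<Rightarrow> ('u \<Rightarrow> 'v)) \<Rightarrow> (('x \<Rightarrow> 'y) \<Rightarrow> bool) \<Rightarrow> 'x topology \<Rightarrow> 'y topology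
     \<Rightarrow> (('u \<Rightarrow> 'v) \<Rightarrow> bool) \<Rightarrow> 'u topology \<Rightarrow> 'v topology \<Rightarrow> bool" where
  "induces_on_htpy_classes \<Phi> P X Y Q U V \<longleftrightarrow>
     \<Phi> \<in> maps_with P X Y \<rightarrow> maps_with Q U V \<and>
     (\<exists>!\<beta>. \<beta> \<in> htpy_classes P X Y \<rightarrow>\<^sub>E htpy_classes Q U V \<and>
        (\<forall>g\<in>maps_with P X Y. \<beta> (htpy_class P X Y g) = htpy_class Q U V (\<Phi> g)))"

end

theory Submission
  imports Defs
begin

text \<open>
  Let \<open>S\<close> be the reflection in \<open>a\<close>, equal to \<open>1\<close> on \<open>a\<close> and to \<open>- 1\<close> on its Hermitian complement.  If
  \<open>A\<close> is the subspace of \<open>W \<oplus> W\<close> identified with \<open>a\<close>, then \<open>K J(A)\<close> maps \<open>(x, y)\<close> to \<open>(- S y, S x)\<close>.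
  It squares to \<open>- 1\<close>, so its exponential is a rotation, and \<open>\<beta>\<^sub>t(A)\<close> is the set of all
  \<open>(x cos \<theta>, S x sin \<theta>)\<close> with \<open>\<theta> = t \<pi> / 2\<close>.  Its orthogonal projection is polynomial in \<open>cos \<theta>\<close>,
  \<open>sin \<theta>\<close> and \<open>S\<close>, which gives joint continuity in \<open>t\<close> and \<open>a\<close>.  It does not depend on \<open>a\<close> at
  \<open>t = 0\<close> and \<open>t = 1\<close>, and is \<open>A\<close> at \<open>t = 1/2\<close>.  The transpose of \<open>S\<close> with respect to \<open>b\<close> is minus
  the reflection in the annihilator of \<open>a\<close>, so taking annihilators turns \<open>t\<close> into \<open>1 - t\<close>.
  Homotopies descend to the suspension because the product of a quotient map with the identity of
  \<open>[0,1]\<close> is a quotient map.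
\<close>

section \<open>Orthogonal projections for Hermitian forms\<close>

text \<open>The scalar multiplication is a parameter, so one set of facts serves \<open>W\<close>
  and, with \<open>dscale\<close>, the doubled space.\<close>

locale hermitian_form = vector_space sc
  for sc :: "complex \<Rightarrow> 'v::ab_group_add \<Rightarrow> 'v" +
  fixes f :: "'v \<Rightarrow> 'v \<Rightarrow> complex"
  assumes form_add_right: "f x (y + z) = f x y + f x z"
    and form_scale_right: "f x (sc c y) = c * f x y"
    and form_hermitian: "f y x = cnj (f x y)"
    and form_positive: "x \<noteq> 0 \<Longrightarrow> 0 < Re (f x x)"
begin

lemma form_add_left: "f (x + y) z = f x z + f y z"
  by (metis form_hermitian form_add_right complex_cnj_add)

lemma form_scale_left: "f (sc c x) y = cnj c * f x y"
  by (metis form_hermitian form_scale_right complex_cnj_mult)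

lemma form_zero_right [simp]: "f x 0 = 0"
  using form_add_right[of x 0 0] by simp

lemma form_zero_left [simp]: "f 0 x = 0"
  using form_add_left[of 0 0 x] by simp

lemma form_minus_right: "f x (- y) = - f x y"
  using form_add_right[of x y "- y"] by (simp add: eq_neg_iff_add_eq_0 add.commute)

lemma form_minus_left: "f (- x) y = - f x y"
  using form_add_left[of x "- x" y] by (simp add: eq_neg_iff_add_eq_0 add.commute)

lemma form_diff_right: "f x (y - z) = f x y - f x z"
  using form_add_right[of x y "- z"] by (simp add: form_minus_right)

lemma form_diff_left: "f (x - y) z = f x z - f y z"
  using form_add_left[of x "- y" z] by (simp add: form_minus_left)

lemma form_eq_0_swap: "f x y = 0 \<Longrightarrow> f y x = 0"
  by (metis form_hermitian complex_cnj_zero)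

lemma form_self_eq_0: "f x x = 0 \<Longrightarrow> x = 0"
  using form_positive by fastforce

lemma subspace_hcomp: "subspace (hcomp f a)"
  by (auto simp: subspace_def hcomp_def form_add_right form_scale_right)

lemma hcompD: "v \<in> hcomp f a \<Longrightarrow> w \<in> a \<Longrightarrow> f w v = 0"
  by (simp add: hcomp_def)

lemma hcompD': "v \<in> hcomp f a \<Longrightarrow> w \<in> a \<Longrightarrow> f v w = 0"
  using hcompD form_eq_0_swap by blast

text \<open>Two candidates for the \<open>THE\<close> in \<open>oproj\<close> differ by a vector
  lying both in \<open>a\<close> and in its complement, hence orthogonal to itself.\<close>

lemma oproj_eqI:
  assumes "subspace a" "w \<in> a" "v - w \<in> hcomp f a"
  shows "oproj f a v = w"
  unfolding oproj_def
proof (rule the_equality)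
  fix w' assume w': "w' \<in> a \<and> v - w' \<in> hcomp f a"
  have "w' - w \<in> a"
    using assms w' subspace_diff by blast
  moreover have "(v - w) - (v - w') \<in> hcomp f a"
    using assms w' subspace_hcomp subspace_diff by blast
  ultimately have "f (w' - w) (w' - w) = 0"
    using hcompD by fastforce
  then show "w' = w"
    using form_self_eq_0 by fastforce
qed (use assms in auto)

text \<open>Gram-Schmidt: a new vector contributes only its component \<open>e\<close> orthogonal to
  the old span.\<close>

lemma span_orthogonal_decomposition:
  assumes "finite B"
  shows "\<exists>w\<in>span B. v - w \<in> hcomp f (span B)"
  using assms
proof (induction B arbitrary: v)
  case empty
  then show ?case by (auto simp: hcomp_def)
next
  case (insert x B)
  obtain w where w: "w \<in> span B" "v - w \<in> hcomp f (span B)"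
    using insert.IH by blast
  obtain y where y: "y \<in> span B" "x - y \<in> hcomp f (span B)"
    using insert.IH by blast
  define e where "e = x - y"
  \<comment> \<open>For \<open>e = 0\<close> the new vector already lies in the old span and nothing
    is added; \<open>ce\<close> holds in both cases.\<close>
  define c where "c = (if e = 0 then 0 else f e v / f e e)"
  have xe: "x = y + e"
    by (simp add: e_def)
  have B_le: "span B \<subseteq> span (insert x B)"
    by (rule span_mono) auto
  have e_in: "e \<in> span (insert x B)"
    unfolding e_def using y(1) B_le by (blast intro: span_diff span_base)
  have ce: "f e v = c * f e e"
    using form_self_eq_0[of e] by (auto simp: c_def)
  have "f u (v - (w + sc c e)) = 0" if u: "u \<in> span (insert x B)" for u
  proof -
    obtain k where k: "u - sc k x \<in> span B"
      using u span_breakdown_eq by blast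
    define u' where "u' = u - sc k x + sc k y"
    have u': "u' \<in> span B"
      unfolding u'_def using k y by (blast intro: span_add span_scale)
    \<comment> \<open>Trading the multiple of \<open>x\<close> for that of its projection
      \<open>y\<close> splits \<open>u\<close> into a part in the old span and a multiple of
      \<open>e\<close>.\<close>
    have "u = u' + sc k e"
      by (simp add: u'_def xe scale_right_distrib)
    moreover have "f u' (v - w) = 0" "f u' e = 0" "f e w = 0"
      using hcompD[OF w(2) u'] hcompD[OF y(2) u'] hcompD'[OF y(2) w(1)] by (simp_all add: e_def)
    ultimately show ?thesis
      by (simp add: form_add_left form_scale_left form_diff_right form_add_right form_scale_right ce)
  qed
  then have "v - (w + sc c e) \<in> hcomp f (span (insert x B))"
    by (simp add: hcomp_def)
  moreover have "w + sc c e \<in> span (insert x B)"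
    using w(1) B_le e_in by (blast intro: span_add span_scale)
  ultimately show ?case by blast
qed

end


section \<open>Reflections in subspaces of the single-particle space\<close>

lemma scaleR_eq_vector_scalar_mult: "r *\<^sub>R (x :: complex ^ 'm) = complex_of_real r *s x"
  unfolding vec_eq_iff vector_scaleR_component vector_smult_component
  by (simp add: scaleR_conv_of_real)

lemma vector_space_dscale: "vector_space dscale"
  by unfold_locales
    (simp_all add: dscale_def prod_eq_iff vec.scale_right_distrib vec.scale_left_distrib)

context clifford_setting
begin

sublocale hermitian_form "(*s)" h
  by unfold_locales
    (use h_linear h_positive h_hermitian[symmetric] in \<open>simp_all add: Vector_Spaces.linear_iff\<close>)

sublocale dbl: hermitian_form dscale "dform h"
proof -
  interpret vector_space dscale
    by (rule vector_space_dscale)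
  show "hermitian_form dscale (dform h)"
  proof unfold_locales
    fix x y :: "'m dbl"
    show "dform h y x = cnj (dform h x y)"
      by (simp add: dform_def form_hermitian[of "fst y"] form_hermitian[of "snd y"])
    show "0 < Re (dform h x x)" if "x \<noteq> 0"
    proof -
      have "0 \<le> Re (h z z)" for z
        using form_positive[of z] by (cases "z = 0") auto
      moreover have "fst x \<noteq> 0 \<or> snd x \<noteq> 0"
        using that by (auto simp: prod_eq_iff)
      ultimately show ?thesis
        using form_positive[of "fst x"] form_positive[of "snd x"]
        by (auto simp: dform_def intro: add_pos_nonneg add_nonneg_pos)
    qed
  qed (simp_all add: dform_def dscale_def form_add_right form_scale_right algebra_simps)
qed

lemma form_scaleR_right: "h x (r *\<^sub>R y) = r * h x y"
  by (simp add: scaleR_eq_vector_scalar_mult form_scale_right)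

lemma form_scaleR_left: "h (r *\<^sub>R x) y = r * h x y"
  by (simp add: scaleR_eq_vector_scalar_mult form_scale_left)

lemma b_add_right: "b x (y + z) = b x y + b x z"
  and b_scale_right: "b x (c *s y) = c * b x y"
  using b_linear by (auto simp: Vector_Spaces.linear_iff)

lemma b_add_left: "b (x + y) z = b x z + b y z"
  by (metis b_symmetric b_add_right)

lemma b_scaleR_right: "b x (r *\<^sub>R y) = r * b x y"
  by (simp add: scaleR_eq_vector_scalar_mult b_scale_right)

lemma b_scaleR_left: "b (r *\<^sub>R x) y = r * b x y"
  by (metis b_symmetric b_scaleR_right)

lemma b_diff_right: "b x (y - z) = b x y - b x z"
  using b_add_right[of x "y - z" z] by simp

lemma b_diff_left: "b (x - y) z = b x z - b y z"
  by (metis b_symmetric b_diff_right)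

lemma orthogonal_decomposition:
  assumes "vec.subspace a"
  obtains p q where "p \<in> a" "q \<in> hcomp h a" "v = p + q"
proof -
  obtain B where B: "B \<subseteq> a" "vec.independent B" "a \<subseteq> vec.span B"
    using vec.basis_exists[of a] by metis
  have "vec.span B = a"
    using B vec.span_minimal[OF B(1) assms] by simp
  moreover have "finite B"
    using B(2) by (rule vec.finiteI_independent)
  ultimately obtain w where "w \<in> a" "v - w \<in> hcomp h a"
    using span_orthogonal_decomposition[of B v] by metis
  with that[of w "v - w"] show thesis by simp
qed

lemma oproj_add_hcomp:
  "vec.subspace a \<Longrightarrow> p \<in> a \<Longrightarrow> q \<in> hcomp h a \<Longrightarrow> oproj h a (p + q) = p"
  by (rule oproj_eqI) auto

text \<open>For the nontrivial inclusion, the component \<open>q\<close> of \<open>v\<close> is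
  orthogonal to both \<open>v\<close> and \<open>p\<close>, hence to itself.\<close>

lemma hcomp_hcomp:
  assumes "vec.subspace a"
  shows "hcomp h (hcomp h a) = a"
proof
  show "a \<subseteq> hcomp h (hcomp h a)"
    by (auto simp: hcomp_def intro: form_eq_0_swap)
  show "hcomp h (hcomp h a) \<subseteq> a"
  proof
    fix v assume v: "v \<in> hcomp h (hcomp h a)"
    obtain p q where pq: "p \<in> a" "q \<in> hcomp h a" "v = p + q"
      using assms by (rule orthogonal_decomposition)
    have "h q v = 0" "h q p = 0"
      using hcompD[OF v] hcompD'[of q a p] pq by auto
    then have "q = 0"
      using pq(3) by (auto intro: form_self_eq_0 simp: form_add_right)
    then show "v \<in> a"
      using pq by simp
  qed
qed

text \<open>This is \<open>- i J(a)\<close> in the notation of the paper.\<close>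

definition reflection :: "(complex ^ 'm) set \<Rightarrow> complex ^ 'm \<Rightarrow> complex ^ 'm" where
  "reflection a x = 2 *\<^sub>R oproj h a x - x"

lemma reflection_add_hcomp:
  "vec.subspace a \<Longrightarrow> p \<in> a \<Longrightarrow> q \<in> hcomp h a \<Longrightarrow> reflection a (p + q) = p - q"
  by (simp add: reflection_def oproj_add_hcomp scaleR_2)

lemma reflection_add:
  assumes a: "vec.subspace a"
  shows "reflection a (x + y) = reflection a x + reflection a y"
proof -
  obtain p q where x: "p \<in> a" "q \<in> hcomp h a" "x = p + q"
    using a by (rule orthogonal_decomposition)
  obtain p' q' where y: "p' \<in> a" "q' \<in> hcomp h a" "y = p' + q'"
    using a by (rule orthogonal_decomposition)
  have "reflection a ((p + p') + (q + q')) = (p + p') - (q + q')"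
    using x y a by (intro reflection_add_hcomp) (auto intro: vec.subspace_add subspace_hcomp)
  then show ?thesis
    using x y a by (simp add: reflection_add_hcomp algebra_simps)
qed

lemma reflection_scale:
  assumes a: "vec.subspace a"
  shows "reflection a (c *s x) = c *s reflection a x"
proof -
  obtain p q where x: "p \<in> a" "q \<in> hcomp h a" "x = p + q"
    using a by (rule orthogonal_decomposition)
  have "reflection a (c *s p + c *s q) = c *s p - c *s q"
    using x a by (intro reflection_add_hcomp) (auto intro: vec.subspace_scale subspace_hcomp)
  then show ?thesis
    using x a by (simp add: reflection_add_hcomp vec.scale_right_distrib vec.scale_right_diff_distrib)
qed

lemma reflection_scaleR: "vec.subspace a \<Longrightarrow> reflection a (r *\<^sub>R x) = r *\<^sub>R reflection a x"
  by (simp add: scaleR_eq_vector_scalar_mult reflection_scale)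

lemma reflection_minus: "vec.subspace a \<Longrightarrow> reflection a (- x) = - reflection a x"
  using reflection_scaleR[of a "- 1" x] by simp

lemma reflection_reflection:
  assumes a: "vec.subspace a"
  shows "reflection a (reflection a x) = x"
proof -
  obtain p q where x: "p \<in> a" "q \<in> hcomp h a" "x = p + q"
    using a by (rule orthogonal_decomposition)
  have "reflection a (p + - q) = p - - q"
    using x a by (intro reflection_add_hcomp) (auto intro: vec.subspace_neg subspace_hcomp)
  then show ?thesis
    using x a by (simp add: reflection_add_hcomp)
qed

lemma reflection_self_adjoint:
  assumes a: "vec.subspace a"
  shows "h (reflection a x) y = h x (reflection a y)"
proof -
  obtain p q where x: "p \<in> a" "q \<in> hcomp h a" "x = p + q"
    using a by (rule orthogonal_decomposition)
  obtain p' q' where y: "p' \<in> a" "q' \<in> hcomp h a" "y = p' + q'"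
    using a by (rule orthogonal_decomposition)
  have "h p q' = 0" "h q p' = 0"
    using x y hcompD hcompD' by blast+
  then show ?thesis
    using x y a by (simp add: reflection_add_hcomp form_add_left form_add_right form_diff_left form_diff_right)
qed

section \<open>Annihilators with respect to the bilinear form\<close>

lemma annih_eq_hcomp: "annih b a = hcomp h (\<gamma> ` a)"
  by (auto simp: annih_def hcomp_def h_eq_b \<gamma>_involution)

lemma subspace_annih: "vec.subspace (annih b a)"
  by (simp add: annih_eq_hcomp subspace_hcomp)

lemma subspace_\<gamma>_image:
  assumes "vec.subspace a"
  shows "vec.subspace (\<gamma> ` a)"
proof -
  have "c *s \<gamma> x = \<gamma> (cnj c *s x)" for c x
    by (simp add: \<gamma>_scale)
  moreover have "\<gamma> 0 = 0"
    using \<gamma>_add[of 0 0] by simp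
  ultimately show ?thesis
    using assms unfolding vec.subspace_def
    by (auto simp flip: \<gamma>_add)
qed

text \<open>Split \<open>x\<close> along \<open>a\<close> and \<open>y\<close> along
  \<open>annih b a\<close>. The pairings \<open>b p p'\<close> and \<open>b q q'\<close> vanish, and
  the mixed ones carry the same signs on both sides.\<close>

lemma b_reflection_left:
  assumes a: "vec.subspace a"
  shows "b (reflection a x) y = - b x (reflection (annih b a) y)"
proof -
  obtain p q where x: "p \<in> a" "q \<in> hcomp h a" "x = p + q"
    using a by (rule orthogonal_decomposition)
  obtain p' q' where y: "p' \<in> annih b a" "q' \<in> hcomp h (annih b a)" "y = p' + q'"
    using subspace_annih by (rule orthogonal_decomposition)
  have "b p p' = 0"
    using x y by (simp add: annih_def)
  \<comment> \<open>The annihilator is the Hermitian complement of the image of \<open>a\<close>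
    under \<gamma>, so its own complement is that image.\<close>
  have "q' \<in> \<gamma> ` a"
    using y(2) a by (simp add: annih_eq_hcomp hcomp_hcomp subspace_\<gamma>_image)
  then obtain w where w: "w \<in> a" "q' = \<gamma> w"
    by blast
  have "b q q' = h w q"
    by (metis w(2) h_eq_b b_symmetric)
  also have "\<dots> = 0"
    using x w hcompD by blast
  finally have "b q q' = 0" .
  then show ?thesis
    using x y a \<open>b p p' = 0\<close> subspace_annih
    by (simp add: reflection_add_hcomp b_add_left b_add_right b_diff_left b_diff_right)
qed

section \<open>The Clifford operators\<close>

lemma j_add: "l \<in> {1..s} \<Longrightarrow> j l (x + y) = j l x + j l y"
  and j_scale: "l \<in> {1..s} \<Longrightarrow> j l (c *s x) = c *s j l x"
  using j_linear by (auto simp: Vector_Spaces.linear_iff)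

lemma j_scaleR: "l \<in> {1..s} \<Longrightarrow> j l (r *\<^sub>R x) = r *\<^sub>R j l x"
  by (simp add: scaleR_eq_vector_scalar_mult j_scale)

lemma j_minus: "l \<in> {1..s} \<Longrightarrow> j l (- x) = - j l x"
  using j_scaleR[of l "- 1" x] by simp

lemma j_j: "l \<in> {1..s} \<Longrightarrow> j l (j l x) = - x"
  using j_clifford[of l l x] by (simp add: vec_eq_iff)

text \<open>\<open>j l\<close> interchanges \<open>a\<close> and its complement, that is, the two
  eigenspaces of the reflection.\<close>

lemma reflection_j:
  assumes a: "vec.subspace a" and l: "l \<in> {1..s}" and ja: "j l ` a = hcomp h a"
  shows "reflection a (j l x) = - j l (reflection a x)"
proof -
  obtain p q where x: "p \<in> a" "q \<in> hcomp h a" "x = p + q"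
    using a by (rule orthogonal_decomposition)
  obtain w where "w \<in> a" "q = j l w"
    using x ja by blast
  \<comment> \<open>Since \<open>j l\<close> squares to minus the identity, it carries the
    complement back into \<open>a\<close>.\<close>
  then have "j l q \<in> a"
    using a l by (simp add: j_j vec.subspace_neg)
  moreover have "j l p \<in> hcomp h a"
    using x ja by blast
  ultimately have "reflection a (j l q + j l p) = j l q - j l p"
    using a by (intro reflection_add_hcomp)
  then show ?thesis
    using x a l by (simp add: reflection_add_hcomp j_add j_minus add.commute flip: add_uminus_conv_diff)
qed


section \<open>The Bott map in terms of reflections\<close>

text \<open>With \<open>c\<close> and \<open>d\<close> the cosine and sine of an angle, this is the
  graph of the reflection scaled by the tangent; the homogeneous form also covers
  \<open>c = 0\<close>.\<close>

definition fibre :: "real \<Rightarrow> real \<Rightarrow> (complex ^ 'm) set \<Rightarrow> 'm dbl set" where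
  "fibre c d a = range (\<lambda>x. (c *\<^sub>R x, d *\<^sub>R reflection a x))"

lemma scaleR_unit_combination: "c\<^sup>2 + d\<^sup>2 = 1 \<Longrightarrow> (c * c) *\<^sub>R x + (d * d) *\<^sub>R x = x"
  for x :: "complex ^ 'm"
  by (simp add: power2_eq_square flip: scaleR_left_distrib)

text \<open>One linear equation for a fibre makes complements, annihilators and images of fibres
  comparable by rewriting.\<close>

lemma mem_fibre:
  assumes a: "vec.subspace a" and cd: "c\<^sup>2 + d\<^sup>2 = 1"
  shows "(u, v) \<in> fibre c d a \<longleftrightarrow> d *\<^sub>R u = c *\<^sub>R reflection a v"
proof
  assume "(u, v) \<in> fibre c d a"
  then show "d *\<^sub>R u = c *\<^sub>R reflection a v"
    using a by (auto simp: fibre_def reflection_scaleR reflection_reflection mult.commute)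
next
  assume eq: "d *\<^sub>R u = c *\<^sub>R reflection a v"
  \<comment> \<open>The parametrisation of the fibre is an isometry, so its adjoint applied to
    \<open>(u, v)\<close> recovers the parameter.\<close>
  define x where "x = c *\<^sub>R u + d *\<^sub>R reflection a v"
  have "c *\<^sub>R x = (c * c) *\<^sub>R u + d *\<^sub>R c *\<^sub>R reflection a v"
    by (simp add: x_def scaleR_right_distrib mult.commute)
  also have "\<dots> = u"
    using cd by (simp add: scaleR_unit_combination flip: eq)
  finally have u: "u = c *\<^sub>R x" ..
  have "d *\<^sub>R reflection a x = c *\<^sub>R reflection a (d *\<^sub>R u) + (d * d) *\<^sub>R v"
    using a by (simp add: x_def reflection_add reflection_scaleR reflection_reflection
        scaleR_right_distrib mult.commute)
  also have "\<dots> = v"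
    using a cd by (simp add: eq reflection_scaleR reflection_reflection scaleR_unit_combination)
  finally show "(u, v) \<in> fibre c d a"
    using u unfolding fibre_def by auto
qed

lemma swap_scaleR_reflection_eq:
  assumes a: "vec.subspace a"
  shows "d *\<^sub>R reflection a u = c *\<^sub>R v \<longleftrightarrow> d *\<^sub>R u = c *\<^sub>R reflection a v"
proof -
  have "d *\<^sub>R reflection a u = c *\<^sub>R v \<longleftrightarrow>
        reflection a (d *\<^sub>R reflection a u) = reflection a (c *\<^sub>R v)"
    using reflection_reflection[OF a] by metis
  then show ?thesis
    using a by (simp add: reflection_scaleR reflection_reflection)
qed

lemma subspace_fibre:
  assumes a: "vec.subspace a"
  shows "dbl.subspace (fibre c d a)"
  unfolding dbl.subspace_def
proof (intro conjI allI ballI)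
  have "(c *\<^sub>R 0, d *\<^sub>R reflection a 0) \<in> fibre c d a"
    unfolding fibre_def by blast
  then show "0 \<in> fibre c d a"
    using reflection_scaleR[OF a, of 0 0] by (simp add: zero_prod_def)
next
  fix p q assume "p \<in> fibre c d a" "q \<in> fibre c d a"
  then obtain x y where "p = (c *\<^sub>R x, d *\<^sub>R reflection a x)" "q = (c *\<^sub>R y, d *\<^sub>R reflection a y)"
    by (auto simp: fibre_def)
  then have "p + q = (c *\<^sub>R (x + y), d *\<^sub>R reflection a (x + y))"
    using a by (simp add: reflection_add scaleR_right_distrib)
  then show "p + q \<in> fibre c d a"
    unfolding fibre_def by blast
next
  fix k p assume "p \<in> fibre c d a"
  then obtain x where "p = (c *\<^sub>R x, d *\<^sub>R reflection a x)"
    by (auto simp: fibre_def)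
  then have "dscale k p = (c *\<^sub>R (k *s x), d *\<^sub>R reflection a (k *s x))"
    using a by (simp add: dscale_def reflection_scale scaleR_eq_vector_scalar_mult mult.commute)
  then show "dscale k p \<in> fibre c d a"
    unfolding fibre_def by blast
qed

text \<open>The dimension is a component of the topology on \<open>grassmannians\<close>; it is
  constant here because the parametrisation by \<open>W\<close> is injective.\<close>

lemma dim_fibre:
  assumes a: "vec.subspace a" and cd: "c\<^sup>2 + d\<^sup>2 = 1"
  shows "dbl.dim (fibre c d a) = CARD('m)"
proof -
  interpret finite_dimensional_vector_space_pair_1 "(*s)" "cart_basis :: (complex ^ 'm) set" dscale
    by (intro finite_dimensional_vector_space_pair_1.intro vec.finite_dimensional_vector_space_axioms
        vector_space_dscale)
  let ?f = "\<lambda>x. (c *\<^sub>R x, d *\<^sub>R reflection a x)"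
  have "Vector_Spaces.linear (*s) dscale ?f"
    using a by (simp add: Vector_Spaces.linear_iff vec.vector_space_axioms vector_space_dscale
        dscale_def reflection_add reflection_scale scaleR_right_distrib
        scaleR_eq_vector_scalar_mult mult.commute)
  moreover have "inj ?f"
  proof (rule injI)
    fix x y assume "?f x = ?f y"
    then have "c *\<^sub>R x = c *\<^sub>R y" "d *\<^sub>R reflection a x = d *\<^sub>R reflection a y"
      by auto
    \<comment> \<open>Not both \<open>c\<close> and \<open>d\<close> vanish; if
      \<open>c = 0\<close>, the second components are compared after undoing the reflection.\<close>
    then show "x = y"
      using cd a by (cases "c = 0") (auto dest: arg_cong[where f = "reflection a"]
          simp: reflection_reflection)
  qed
  ultimately have "dbl.dim (fibre c d a) = vec.dim (UNIV :: (complex ^ 'm) set)"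
    unfolding fibre_def by (intro dim_image_eq) (auto intro: inj_on_subset)
  then show ?thesis
    by (simp add: card_cart_basis)
qed

text \<open>Self-adjointness of the reflection turns orthogonality into one linear equation, that of
  the fibre with its angle moved by \<open>pi / 2\<close>.\<close>

lemma hcomp_fibre:
  assumes a: "vec.subspace a" and cd: "c\<^sup>2 + d\<^sup>2 = 1"
  shows "hcomp (dform h) (fibre c d a) = fibre d (- c) a"
proof (rule set_eqI)
  fix p :: "'m dbl"
  obtain u v where p: "p = (u, v)"
    by (cases p)
  have "dform h (c *\<^sub>R x, d *\<^sub>R reflection a x) p = h x (c *\<^sub>R u + d *\<^sub>R reflection a v)" for x
    using a by (simp add: p dform_def form_scaleR_left form_scaleR_right form_add_right
        reflection_self_adjoint)
  then have "p \<in> hcomp (dform h) (fibre c d a) \<longleftrightarrow> (\<forall>x. h x (c *\<^sub>R u + d *\<^sub>R reflection a v) = 0)"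
    by (simp add: hcomp_def fibre_def)
  also have "\<dots> \<longleftrightarrow> c *\<^sub>R u + d *\<^sub>R reflection a v = 0"
    using form_self_eq_0 by auto
  also have "\<dots> \<longleftrightarrow> - c *\<^sub>R u = d *\<^sub>R reflection a v"
    by (auto simp: add_eq_0_iff)
  also have "\<dots> \<longleftrightarrow> p \<in> fibre d (- c) a"
    using a cd by (simp add: p mem_fibre add.commute)
  finally show "p \<in> hcomp (dform h) (fibre c d a) \<longleftrightarrow> p \<in> fibre d (- c) a" .
qed

text \<open>The transpose of the reflection for \<open>b\<close> is minus the reflection in the
  annihilator. This sign is why \<open>c\<close> and \<open>d\<close> are exchanged without the
  change of sign in \<open>hcomp_fibre\<close>.\<close>

lemma annih_fibre:
  assumes a: "vec.subspace a" and cd: "c\<^sup>2 + d\<^sup>2 = 1"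
  shows "annih (dform b) (fibre c d a) = fibre d c (annih b a)"
proof (rule set_eqI)
  fix p :: "'m dbl"
  obtain u v where p: "p = (u, v)"
    by (cases p)
  let ?w = "c *\<^sub>R u - d *\<^sub>R reflection (annih b a) v"
  have "dform b (c *\<^sub>R x, d *\<^sub>R reflection a x) p = b x ?w" for x
    using a by (simp add: p dform_def b_scaleR_left b_scaleR_right b_diff_right b_reflection_left)
  then have "p \<in> annih (dform b) (fibre c d a) \<longleftrightarrow> (\<forall>x. b x ?w = 0)"
    by (simp add: annih_def fibre_def)
  also have "\<dots> \<longleftrightarrow> ?w = 0"
    using b_nondegenerate[of ?w] b_symmetric b_scaleR_right[of _ 0 0] by auto
  also have "\<dots> \<longleftrightarrow> p \<in> fibre d c (annih b a)"
    using cd subspace_annih by (simp add: p mem_fibre add.commute)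
  finally show "p \<in> annih (dform b) (fibre c d a) \<longleftrightarrow> p \<in> fibre d c (annih b a)" .
qed

text \<open>The projection onto the image of an isometry is the isometry composed with its
  adjoint.\<close>

lemma oproj_fibre:
  assumes a: "vec.subspace a" and cd: "c\<^sup>2 + d\<^sup>2 = 1"
  shows "oproj (dform h) (fibre c d a) (u, v) =
    ((c * c) *\<^sub>R u + (c * d) *\<^sub>R reflection a v, (c * d) *\<^sub>R reflection a u + (d * d) *\<^sub>R v)"
proof (rule dbl.oproj_eqI[OF subspace_fibre[OF a]])
  let ?w = "((c * c) *\<^sub>R u + (c * d) *\<^sub>R reflection a v, (c * d) *\<^sub>R reflection a u + (d * d) *\<^sub>R v)"
  have w: "?w = (c *\<^sub>R (c *\<^sub>R u + d *\<^sub>R reflection a v), d *\<^sub>R reflection a (c *\<^sub>R u + d *\<^sub>R reflection a v))"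
    using a by (simp add: reflection_add reflection_scaleR reflection_reflection
        scaleR_right_distrib mult.commute)
  show "?w \<in> fibre c d a"
    unfolding w fibre_def by blast
  have "(u, v) = ((c * c) *\<^sub>R u + (d * d) *\<^sub>R u, (c * c) *\<^sub>R v + (d * d) *\<^sub>R v)"
    using cd by (simp add: scaleR_unit_combination)
  \<comment> \<open>The residual is the point of \<open>fibre d (- c) a\<close> with parameter
    \<open>d *\<^sub>R u - c *\<^sub>R reflection a v\<close>.\<close>
  then have "(u, v) - ?w = (d *\<^sub>R (d *\<^sub>R u - c *\<^sub>R reflection a v), (- c) *\<^sub>R (c *\<^sub>R - v + d *\<^sub>R reflection a u))"
    by (simp add: algebra_simps)
  also have "c *\<^sub>R - v + d *\<^sub>R reflection a u = reflection a (d *\<^sub>R u - c *\<^sub>R reflection a v)"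
    using a reflection_add[OF a, of "d *\<^sub>R u" "- (c *\<^sub>R reflection a v)"]
    by (simp add: reflection_scaleR reflection_minus reflection_reflection)
  finally have eq: "(u, v) - ?w = (d *\<^sub>R (d *\<^sub>R u - c *\<^sub>R reflection a v),
      (- c) *\<^sub>R reflection a (d *\<^sub>R u - c *\<^sub>R reflection a v))" .
  show "(u, v) - ?w \<in> hcomp (dform h) (fibre c d a)"
    unfolding hcomp_fibre[OF a cd] eq unfolding fibre_def by blast
qed

text \<open>The reflection exchanges \<open>w + w'\<close> and \<open>w - w'\<close>, which singles
  out equal cosine and sine, the angle \<open>pi / 4\<close>.\<close>

lemma dbl_sub_eq_fibre:
  assumes a: "vec.subspace a"
  shows "dbl_sub h a = fibre (sqrt (1/2)) (sqrt (1/2)) a"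
proof (rule set_eqI)
  fix p :: "'m dbl"
  obtain u v where p: "p = (u, v)"
    by (cases p)
  have "p \<in> dbl_sub h a \<longleftrightarrow> u = reflection a v"
  proof
    assume "p \<in> dbl_sub h a"
    then obtain w w' where w: "w \<in> a" "w' \<in> hcomp h a" "u = w + w'" "v = w - w'"
      by (auto simp: dbl_sub_def p)
    then have "reflection a u = v"
      using a by (simp add: reflection_add_hcomp)
    then show "u = reflection a v"
      using reflection_reflection[OF a] by metis
  next
    assume u: "u = reflection a v"
    obtain w w' where w: "w \<in> a" "w' \<in> hcomp h a" "v = w + w'"
      using a by (rule orthogonal_decomposition)
    then have "u = w + - w'" "v = w - - w'" "- w' \<in> hcomp h a"
      using a u by (auto simp: reflection_add_hcomp intro: vec.subspace_neg subspace_hcomp)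
    then show "p \<in> dbl_sub h a"
      using w(1) unfolding p dbl_sub_def by blast
  qed
  also have "\<dots> \<longleftrightarrow> p \<in> fibre (sqrt (1/2)) (sqrt (1/2)) a"
    using a by (simp add: p mem_fibre)
  finally show "p \<in> dbl_sub h a \<longleftrightarrow> p \<in> fibre (sqrt (1/2)) (sqrt (1/2)) a" .
qed

lemma K_J_dbl_sub:
  assumes a: "vec.subspace a"
  shows "K_op (J_of h (dbl_sub h a) (x, y)) = (- reflection a y, reflection a x)"
proof -
  let ?r = "sqrt (1/2)"
  have r: "?r\<^sup>2 + ?r\<^sup>2 = 1" "?r\<^sup>2 + (- ?r)\<^sup>2 = 1"
    by simp_all
  \<comment> \<open>The diagonal entries of the two projections cancel and the off-diagonal ones, of
    opposite sign, add up.\<close>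
  have "oproj (dform h) (dbl_sub h a) (x, y) - oproj (dform h) (hcomp (dform h) (dbl_sub h a)) (x, y)
      = (reflection a y, reflection a x)"
    using a unfolding dbl_sub_eq_fibre[OF a] hcomp_fibre[OF a r(1)] oproj_fibre[OF a r(1)]
      oproj_fibre[OF a r(2)]
    by (simp add: flip: scaleR_left_distrib)
  \<comment> \<open>The factor i of \<open>J_of\<close> meets i and -i in \<open>K_op\<close>, which
    gives the signs -1 and 1.\<close>
  then show ?thesis
    by (simp add: J_of_def K_op_def dscale_def tens_def)
qed

end

text \<open>Even powers of \<open>N\<close> are the identity and odd ones \<open>N\<close>, up to
  sign, so the exponential series separates into those of cosine and sine.\<close>

lemma op_exp_rotation:
  fixes N :: "'v::real_normed_vector \<Rightarrow> 'v"
  assumes scaleR: "\<And>r v. N (r *\<^sub>R v) = r *\<^sub>R N v" and add: "\<And>v w. N (v + w) = N v + N w"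
    and square: "\<And>v. N (N v) = - v"
  shows "op_exp (\<lambda>v. \<theta> *\<^sub>R N v) v = cos \<theta> *\<^sub>R v + sin \<theta> *\<^sub>R N v"
proof -
  let ?T = "\<lambda>v. \<theta> *\<^sub>R N v"
  \<comment> \<open>\<open>cos_coeff k\<close> and \<open>sin_coeff k\<close> carry the parity, the
    sign and a factor \<open>1 / fact k\<close>, so one formula covers all residues of
    \<open>k\<close> modulo 4.\<close>
  have power: "(?T ^^ k) v = (fact k * \<theta> ^ k) *\<^sub>R (cos_coeff k *\<^sub>R v + sin_coeff k *\<^sub>R N v)" for k
  proof (induction k)
    case (Suc k)
    have "(?T ^^ Suc k) v = \<theta> *\<^sub>R (fact k * \<theta> ^ k) *\<^sub>R (cos_coeff k *\<^sub>R N v - sin_coeff k *\<^sub>R v)"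
      by (simp add: Suc.IH scaleR add square)
    also have "\<dots> = (fact (Suc k) * \<theta> ^ Suc k) *\<^sub>R (cos_coeff (Suc k) *\<^sub>R v + sin_coeff (Suc k) *\<^sub>R N v)"
      by (simp add: sin_coeff_Suc cos_coeff_Suc scaleR_right_distrib scaleR_right_diff_distrib
          field_simps del: of_nat_Suc)
    finally show ?case .
  qed (simp add: cos_coeff_0 sin_coeff_0)
  have "(?T ^^ k) v /\<^sub>R fact k
      = (cos_coeff k *\<^sub>R \<theta> ^ k) *\<^sub>R v + (sin_coeff k *\<^sub>R \<theta> ^ k) *\<^sub>R N v" for k
  proof -
    have cancel: "(fact k * \<theta> ^ k) *\<^sub>R w /\<^sub>R fact k = \<theta> ^ k *\<^sub>R w" for w :: 'v
      by simp
    show ?thesis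
      unfolding power cancel by (simp add: scaleR_right_distrib mult.commute)
  qed
  moreover have "(\<lambda>k. (cos_coeff k *\<^sub>R \<theta> ^ k) *\<^sub>R v + (sin_coeff k *\<^sub>R \<theta> ^ k) *\<^sub>R N v)
      sums (cos \<theta> *\<^sub>R v + sin \<theta> *\<^sub>R N v)"
    by (intro sums_add sums_scaleR_left cos_converges sin_converges)
  ultimately show ?thesis
    by (simp add: op_exp_def sums_iff)
qed

section \<open>Values of the Bott map and the conditions defining \<open>C_s1\<close>\<close>

context clifford_setting
begin

lemma beta_dbl_sub:
  assumes a: "vec.subspace a"
  shows "beta h t (dbl_sub h a) = fibre (cos (t * pi / 2)) (sin (t * pi / 2)) a"
proof -
  let ?\<theta> = "t * pi / 2" and ?N = "\<lambda>v. (- reflection a (snd v), reflection a (fst v))"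
  have N: "K_op (J_of h (dbl_sub h a) v) = ?N v" for v
    using a by (cases v) (simp add: K_J_dbl_sub)
  have "op_exp (\<lambda>v. ?\<theta> *\<^sub>R ?N v) v = cos ?\<theta> *\<^sub>R v + sin ?\<theta> *\<^sub>R ?N v" for v
    using a
    by (intro op_exp_rotation)
      (simp_all add: reflection_scaleR reflection_add reflection_minus reflection_reflection prod_eq_iff)
  \<comment> \<open>\<open>K_op\<close> is i on the first summand and -i on the second, so the
    rotation is only needed on vectors \<open>(x, 0)\<close>.\<close>
  moreover have E_plus: "E_plus = range (\<lambda>x :: complex ^ 'm. (x, 0))"
  proof -
    have "v \<in> E_plus \<longleftrightarrow> snd v = 0" for v :: "'m dbl"
    proof -
      have "v \<in> E_plus \<longleftrightarrow> (- \<i>) *s snd v = \<i> *s snd v"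
        by (simp add: E_plus_def K_op_def tens_def dscale_def prod_eq_iff)
      also have "\<dots> \<longleftrightarrow> snd v = 0"
        by (auto simp: vec_eq_iff)
      finally show ?thesis .
    qed
    then show ?thesis
      by (auto simp: prod_eq_iff image_iff)
  qed
  ultimately show ?thesis
    using a unfolding beta_def N E_plus fibre_def
    by (simp add: image_image reflection_scaleR[of a 0 0, simplified])
qed

lemma subspace_Cspace: "a \<in> topspace (C_s h s j) \<Longrightarrow> vec.subspace a"
  by (simp add: C_s_def Cspace_def grassmannians_def topspace_pullback_topology)

text \<open>Independence of \<open>a\<close> here and in \<open>beta_1\<close> makes the family well
  defined on the two collapsed ends of the suspension.\<close>

lemma beta_0: "vec.subspace a \<Longrightarrow> beta h 0 (dbl_sub h a) = range (\<lambda>x. (x, 0))"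
  by (simp add: beta_dbl_sub fibre_def)

lemma beta_1:
  assumes a: "vec.subspace a"
  shows "beta h 1 (dbl_sub h a) = range (Pair 0)"
proof -
  have "surj (reflection a)"
    using reflection_reflection[OF a] by (metis surjI)
  then have "range (\<lambda>x. Pair 0 (reflection a x)) = range (Pair 0 :: _ \<Rightarrow> 'm dbl)"
    by (metis image_image)
  then show ?thesis
    using a by (simp add: beta_dbl_sub fibre_def)
qed

text \<open>This sends the base point of the suspension, at parameter 1/2, to the base point of
  \<open>C_s1\<close>.\<close>

lemma beta_half:
  assumes a: "vec.subspace a"
  shows "beta h (1/2) (dbl_sub h a) = dbl_sub h a"
proof -
  have "sqrt 2 / 2 = sqrt (1/2)" "1/2 * pi / 2 = pi / 4"
    by (simp_all add: real_sqrt_divide field_simps)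
  then have "cos (1/2 * pi / 2) = sqrt (1/2)" "sin (1/2 * pi / 2) = sqrt (1/2)"
    by (simp_all only: cos_45 sin_45)
  then show ?thesis
    unfolding beta_dbl_sub[OF a] by (simp only: dbl_sub_eq_fibre[OF a])
qed

lemma annih_beta:
  assumes a: "vec.subspace a"
  shows "annih (dform b) (beta h t (dbl_sub h a)) = beta h (1 - t) (dbl_sub h (annih b a))"
proof -
  \<comment> \<open>\<open>annih_fibre\<close> exchanges cosine and sine, which replaces the angle
    by its complement to \<open>pi / 2\<close>.\<close>
  have eq: "(1 - t) * pi / 2 = pi / 2 - t * pi / 2"
    by (simp add: field_simps)
  have "cos ((1 - t) * pi / 2) = sin (t * pi / 2)" "sin ((1 - t) * pi / 2) = cos (t * pi / 2)"
    unfolding eq using cos_diff[of "pi / 2" "t * pi / 2"] sin_diff[of "pi / 2" "t * pi / 2"]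
    by simp_all
  then show ?thesis
    using a subspace_annih by (simp add: beta_dbl_sub annih_fibre)
qed

lemma I_op_fibre:
  assumes a: "vec.subspace a" and cd: "c\<^sup>2 + d\<^sup>2 = 1"
  shows "I_op ` fibre c d a = hcomp (dform h) (fibre c d a)"
proof (rule set_eqI)
  fix p :: "'m dbl"
  obtain u v where p: "p = (u, v)"
    by (cases p)
  \<comment> \<open>\<open>(- v, u)\<close> is the preimage of \<open>(u, v)\<close> under
    \<open>I_op\<close>.\<close>
  have "p \<in> I_op ` fibre c d a \<longleftrightarrow> (- v, u) \<in> fibre c d a"
    by (force simp: p I_op_def tens_def image_iff)
  also have "\<dots> \<longleftrightarrow> - (d *\<^sub>R v) = c *\<^sub>R reflection a u"
    using a cd by (simp add: mem_fibre)
  also have "\<dots> \<longleftrightarrow> (- c) *\<^sub>R reflection a u = d *\<^sub>R v"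
    by (auto simp: minus_equation_iff)
  also have "\<dots> \<longleftrightarrow> (- c) *\<^sub>R u = d *\<^sub>R reflection a v"
    using a by (rule swap_scaleR_reflection_eq)
  also have "\<dots> \<longleftrightarrow> p \<in> fibre d (- c) a"
    using a cd by (simp add: p mem_fibre add.commute)
  finally show "p \<in> I_op ` fibre c d a \<longleftrightarrow> p \<in> hcomp (dform h) (fibre c d a)"
    using a cd by (simp add: hcomp_fibre)
qed

text \<open>The reflection anticommutes with \<open>j l\<close>; once the injective
  \<open>j l\<close> is cancelled, the equation is the one met for \<open>I_op\<close>.\<close>

lemma J_op_fibre:
  assumes a: "vec.subspace a" and cd: "c\<^sup>2 + d\<^sup>2 = 1"
    and l: "l \<in> {1..s}" and ja: "j l ` a = hcomp h a"
  shows "J_op j l ` fibre c d a = hcomp (dform h) (fibre c d a)"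
proof (rule set_eqI)
  fix p :: "'m dbl"
  obtain u v where p: "p = (u, v)"
    by (cases p)
  have inj_j: "j l x = j l y \<longleftrightarrow> x = y" for x y
    using j_j[OF l] by (metis neg_equal_iff_equal)
  \<comment> \<open>The inverse of \<open>j l\<close> is \<open>- j l\<close>, and
    \<open>J_op\<close> also swaps the components.\<close>
  have "p \<in> J_op j l ` fibre c d a \<longleftrightarrow> (- j l v, - j l u) \<in> fibre c d a"
  proof
    assume "p \<in> J_op j l ` fibre c d a"
    then obtain q where "q \<in> fibre c d a" "u = j l (snd q)" "v = j l (fst q)"
      by (auto simp: p J_op_def tens_def)
    then show "(- j l v, - j l u) \<in> fibre c d a"
      by (simp add: j_j[OF l])
  next
    assume "(- j l v, - j l u) \<in> fibre c d a"
    moreover have "p = J_op j l (- j l v, - j l u)"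
      by (simp add: p J_op_def tens_def j_minus[OF l] j_j[OF l])
    ultimately show "p \<in> J_op j l ` fibre c d a"
      by blast
  qed
  also have "\<dots> \<longleftrightarrow> d *\<^sub>R - j l v = c *\<^sub>R j l (reflection a u)"
    using a cd by (simp add: mem_fibre reflection_minus reflection_j[OF a l ja])
  also have "\<dots> \<longleftrightarrow> j l (d *\<^sub>R v) = j l ((- c) *\<^sub>R reflection a u)"
    by (simp add: j_scaleR[OF l] j_minus[OF l]) (metis minus_minus)
  also have "\<dots> \<longleftrightarrow> (- c) *\<^sub>R reflection a u = d *\<^sub>R v"
    by (auto simp: inj_j)
  also have "\<dots> \<longleftrightarrow> (- c) *\<^sub>R u = d *\<^sub>R reflection a v"
    using a by (rule swap_scaleR_reflection_eq)
  also have "\<dots> \<longleftrightarrow> p \<in> fibre d (- c) a"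
    using a cd by (simp add: p mem_fibre add.commute)
  finally show "p \<in> J_op j l ` fibre c d a \<longleftrightarrow> p \<in> hcomp (dform h) (fibre c d a)"
    using a cd by (simp add: hcomp_fibre)
qed

end


section \<open>Continuity of the Bott map\<close>

text \<open>Continuity into a pullback topology is tested after composition; pointwise convergence
  then reduces the projection to its values at single vectors.\<close>

lemma continuous_map_grassmannians:
  fixes g :: "'x \<Rightarrow> 'v::{ab_group_add,topological_space} set"
  shows "continuous_map X (grassmannians sc f) g \<longleftrightarrow>
    (\<forall>x\<in>topspace X. module.subspace sc (g x)) \<and>
    continuous_map X euclidean (\<lambda>x. vector_space.dim sc (g x)) \<and>
    (\<forall>v. continuous_map X euclidean (\<lambda>x. oproj f (g x) v))"
    (is "?lhs \<longleftrightarrow> ?sub \<and> ?dim \<and> ?proj")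
proof -
  let ?P = "\<lambda>a. (vector_space.dim sc a, oproj f a)"
  have "?lhs \<longleftrightarrow> ?sub \<and> continuous_map X euclidean (?P \<circ> g)"
  proof
    assume g: ?lhs
    have "continuous_map (grassmannians sc f) euclidean (id \<circ> ?P)"
      unfolding grassmannians_def by (intro continuous_map_pullback continuous_map_id)
    from continuous_map_compose[OF g this] have "continuous_map X euclidean (?P \<circ> g)"
      by (simp only: id_comp)
    moreover have ?sub
      using continuous_map_image_subset_topspace[OF g]
      by (auto simp: grassmannians_def topspace_pullback_topology)
    ultimately show "?sub \<and> continuous_map X euclidean (?P \<circ> g)"
      by blast
  next
    assume "?sub \<and> continuous_map X euclidean (?P \<circ> g)"
    then show ?lhs
      unfolding grassmannians_def by (intro continuous_map_pullback') auto
  qed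
  also have "continuous_map X euclidean (?P \<circ> g) \<longleftrightarrow>
      ?dim \<and> continuous_map X euclidean (\<lambda>x. oproj f (g x))"
    by (simp add: continuous_map_pairwise o_def flip: prod_topology_euclidean)
  also have "continuous_map X euclidean (\<lambda>x. oproj f (g x)) \<longleftrightarrow> ?proj"
    by (simp add: continuous_map_componentwise_UNIV flip: euclidean_product_topology)
  finally show ?thesis .
qed

lemma continuous_map_Cspace:
  "continuous_map X (Cspace sc f \<T>) g \<longleftrightarrow> continuous_map X (grassmannians sc f) g \<and>
    (\<forall>x\<in>topspace X. \<forall>T\<in>\<T>. T ` g x = hcomp f (g x))"
  by (auto simp: Cspace_def continuous_map_in_subtopology)

lemma continuous_map_scaleR:
  fixes g :: "'x \<Rightarrow> 'v::real_normed_vector"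
  assumes "continuous_map X euclideanreal f" "continuous_map X euclidean g"
  shows "continuous_map X euclidean (\<lambda>x. f x *\<^sub>R g x)"
  using assms by (simp add: continuous_map_atin tendsto_scaleR)

context clifford_setting
begin

text \<open>Letting the parameter \<open>f\<close> vary over an arbitrary \<open>X\<close> gives the
  joint continuity in parameter and subspace that homotopies need.\<close>

lemma continuous_map_beta:
  assumes g: "continuous_map X (C_s h s j) g" and f: "continuous_map X euclideanreal f"
  shows "continuous_map X (C_s1 h s j) (\<lambda>x. beta h (f x) (dbl_sub h (g x)))"
proof -
  let ?c = "\<lambda>x. cos (f x * pi / 2)" and ?d = "\<lambda>x. sin (f x * pi / 2)"
  have sub: "vec.subspace (g x)" and j_g: "\<And>l. l \<in> {1..s} \<Longrightarrow> j l ` g x = hcomp h (g x)"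
    if "x \<in> topspace X" for x
    using g that by (simp_all add: C_s_def continuous_map_Cspace continuous_map_grassmannians)
  have "continuous_map X euclidean (\<lambda>x. oproj h (g x) v)" for v
    using g by (simp add: C_s_def continuous_map_Cspace continuous_map_grassmannians)
  then have reflection: "continuous_map X euclidean (\<lambda>x. reflection (g x) v)" for v
    unfolding reflection_def
    by (intro continuous_map_diff continuous_map_scaleR) simp_all
  have "continuous_on UNIV (\<lambda>t :: real. cos (t * pi / 2))" "continuous_on UNIV (\<lambda>t :: real. sin (t * pi / 2))"
    by (auto intro!: continuous_intros)
  then have c: "continuous_map X euclideanreal ?c" and d: "continuous_map X euclideanreal ?d"
    using continuous_map_compose[OF f, of euclideanreal "\<lambda>t. cos (t * pi / 2)"]
      continuous_map_compose[OF f, of euclideanreal "\<lambda>t. sin (t * pi / 2)"]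
    by (simp_all add: o_def)
  have cd: "(?c x)\<^sup>2 + (?d x)\<^sup>2 = 1" for x
    by simp
  have "continuous_map X (C_s1 h s j) (\<lambda>x. fibre (?c x) (?d x) (g x))"
    unfolding C_s1_def continuous_map_Cspace continuous_map_grassmannians
  proof (intro conjI ballI allI)
    \<comment> \<open>On \<open>topspace X\<close> this function into a discrete space is
      constant.\<close>
    show "continuous_map X euclidean (\<lambda>x. dbl.dim (fibre (?c x) (?d x) (g x)))"
    proof (rule continuous_map_eq)
      show "continuous_map X euclidean (\<lambda>x. CARD('m))"
        by simp
    qed (use sub cd in \<open>simp add: dim_fibre\<close>)
  next
    fix p :: "'m dbl"
    obtain u v where p: "p = (u, v)"
      by (cases p)
    show "continuous_map X euclidean (\<lambda>x. oproj (dform h) (fibre (?c x) (?d x) (g x)) p)"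
    proof (rule continuous_map_eq)
      have "continuous_map X (prod_topology euclidean euclidean)
        (\<lambda>x. ((?c x * ?c x) *\<^sub>R u + (?c x * ?d x) *\<^sub>R reflection (g x) v,
              (?c x * ?d x) *\<^sub>R reflection (g x) u + (?d x * ?d x) *\<^sub>R v))"
        by (intro continuous_map_pairedI continuous_map_add continuous_map_scaleR
            continuous_map_real_mult c d reflection) simp_all
      then show "continuous_map X euclidean
        (\<lambda>x. ((?c x * ?c x) *\<^sub>R u + (?c x * ?d x) *\<^sub>R reflection (g x) v,
              (?c x * ?d x) *\<^sub>R reflection (g x) u + (?d x * ?d x) *\<^sub>R v))"
        by (simp only: prod_topology_euclidean)
    qed (use sub cd in \<open>simp add: oproj_fibre p\<close>)
  next
    fix x T assume x: "x \<in> topspace X" and "T \<in> insert I_op (J_op j ` {1..s})"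
    then consider "T = I_op" | l where "l \<in> {1..s}" "T = J_op j l"
      by blast
    then show "T ` fibre (?c x) (?d x) (g x) = hcomp (dform h) (fibre (?c x) (?d x) (g x))"
    proof cases
      case 1
      then show ?thesis
        using I_op_fibre[OF sub[OF x] cd] by simp
    next
      case 2
      then show ?thesis
        using J_op_fibre[OF sub[OF x] cd 2(1) j_g[OF x 2(1)]] by simp
    qed
  qed (use sub in \<open>simp add: subspace_fibre\<close>)
  then show ?thesis
    by (rule continuous_map_eq) (use sub in \<open>simp add: beta_dbl_sub\<close>)
qed

text \<open>At an end of the suspension a class contains points over every \<open>k\<close>, and
  \<open>beta_0\<close> or \<open>beta_1\<close> gives agreement; elsewhere a class is a single
  point.\<close>

lemma bott_map_susp_pt:
  assumes g: "\<And>k. k \<in> topspace M \<Longrightarrow> g k \<in> topspace (C_s h s j)"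
    and kt: "k \<in> topspace M" "t \<in> {0..1}"
  shows "bott_map h g (susp_pt M k t) = beta h t (dbl_sub h (g k))"
  unfolding bott_map_def
proof (rule the_equality)
  have sub: "vec.subspace (g k)" if "k \<in> topspace M" for k
    using g[OF that] by (rule subspace_Cspace)
  show "\<forall>(k', t')\<in>susp_pt M k t. beta h t (dbl_sub h (g k)) = beta h t' (dbl_sub h (g k'))"
    using kt sub by (auto simp: susp_pt_def susp_rel_def beta_0 beta_1)
  have kt_in: "(k, t) \<in> susp_pt M k t"
    using kt by (auto simp: susp_pt_def susp_rel_def)
  show "B = beta h t (dbl_sub h (g k))"
    if "\<forall>(k', t')\<in>susp_pt M k t. B = beta h t' (dbl_sub h (g k'))" for B
    using bspec[OF that kt_in] by simp
qed

end

section \<open>The suspension and its involution\<close>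

lemma quotient_map_susp_pt:
  "quotient_map (prod_topology M (top_of_set {0..1})) (susp M) (\<lambda>(k, t). susp_pt M k t)"
proof -
  have "equiv (topspace (prod_topology M (top_of_set {0..1}))) (susp_rel M)"
    using equiv_susp_rel by simp
  then show ?thesis
    unfolding susp_def susp_pt_def
    by (simp add: case_prod_unfold quotient_map_quotient_top)
qed

lemma susp_cases:
  assumes "c \<in> topspace (susp M)"
  obtains k t where "k \<in> topspace M" "t \<in> {0..1}" "c = susp_pt M k t"
  using assms quotient_imp_surjective_map[OF quotient_map_susp_pt[of M], symmetric] by auto

lemma susp_inv_susp_pt:
  assumes \<tau>: "\<tau> \<in> topspace M \<rightarrow> topspace M" and inv: "\<And>k. k \<in> topspace M \<Longrightarrow> \<tau> (\<tau> k) = k"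
    and kt: "k \<in> topspace M" "t \<in> {0..1}"
  shows "susp_inv \<tau> (susp_pt M k t) = susp_pt M (\<tau> k) (1 - t)"
proof
  have step: "susp_inv \<tau> (susp_pt M k t) \<subseteq> susp_pt M (\<tau> k) (1 - t)"
    if "k \<in> topspace M" "t \<in> {0..1}" for k t
    using \<tau> that by (auto simp: susp_inv_def susp_pt_def susp_rel_def)
  then show "susp_inv \<tau> (susp_pt M k t) \<subseteq> susp_pt M (\<tau> k) (1 - t)"
    using kt by blast
  \<comment> \<open>The reverse inclusion comes from the first one at the image point, by applying
    the involution once more.\<close>
  have "susp_inv \<tau> (susp_pt M (\<tau> k) (1 - t)) \<subseteq> susp_pt M k t"
    using step[of "\<tau> k" "1 - t"] \<tau> kt inv by auto
  then have "susp_inv \<tau> (susp_inv \<tau> (susp_pt M (\<tau> k) (1 - t))) \<subseteq> susp_inv \<tau> (susp_pt M k t)"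
    unfolding susp_inv_def by (rule image_mono)
  moreover have "susp_inv \<tau> (susp_inv \<tau> (susp_pt M (\<tau> k) (1 - t))) = susp_pt M (\<tau> k) (1 - t)"
  proof -
    have "fst p \<in> topspace M" if "p \<in> susp_pt M (\<tau> k) (1 - t)" for p
      using that by (auto simp: susp_pt_def susp_rel_def)
    then have "(\<lambda>p. (\<tau> (\<tau> (fst p)), 1 - (1 - snd p))) ` susp_pt M (\<tau> k) (1 - t)
        = (\<lambda>p. p) ` susp_pt M (\<tau> k) (1 - t)"
      by (intro image_cong) (simp_all add: inv)
    then show ?thesis
      by (simp add: susp_inv_def image_image case_prod_unfold)
  qed
  ultimately show "susp_pt M (\<tau> k) (1 - t) \<subseteq> susp_inv \<tau> (susp_pt M k t)"
    by simp
qed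

section \<open>Induced maps of homotopy classes\<close>

lemma equiv_htpy_rel: "equiv (maps_with P X Y) (htpy_rel P X Y)"
proof (rule equivI)
  show "htpy_rel P X Y \<subseteq> maps_with P X Y \<times> maps_with P X Y"
    by (auto simp: htpy_rel_def maps_with_def
        dest: homotopic_with_imp_continuous_maps homotopic_with_imp_property)
  show "refl_on (maps_with P X Y) (htpy_rel P X Y)"
    by (auto simp: refl_on_def htpy_rel_def maps_with_def)
  show "sym (htpy_rel P X Y)"
    by (auto simp: htpy_rel_def intro!: symI homotopic_with_symD)
  show "trans (htpy_rel P X Y)"
    unfolding htpy_rel_def by (intro transI CollectI case_prodI) (blast intro: homotopic_with_trans)
qed

text \<open>Compatibility with homotopies suffices: for a constant homotopy it already says that
  maps of kind \<open>P\<close> go to maps of kind \<open>Q\<close>.\<close>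

lemma induces_on_htpy_classesI:
  assumes hom: "\<And>f g. homotopic_with P X Y f g \<Longrightarrow> homotopic_with Q U V (\<Phi> f) (\<Phi> g)"
  shows "induces_on_htpy_classes \<Phi> P X Y Q U V"
proof -
  have maps: "\<Phi> g \<in> maps_with Q U V" if "g \<in> maps_with P X Y" for g
    using hom[of g g] that by (simp add: maps_with_def)
  have class_eq: "htpy_class Q U V (\<Phi> f) = htpy_class Q U V (\<Phi> g)"
    if "(f, g) \<in> htpy_rel P X Y" for f g
    using hom[of f g] that equiv_class_eq[OF equiv_htpy_rel] by (simp add: htpy_class_def htpy_rel_def)
  \<comment> \<open>By \<open>class_eq\<close> the chosen representative does not matter; the
    restriction to classes makes \<open>B\<close> extensional, which uniqueness requires.\<close>
  define B where "B = (\<lambda>C\<in>htpy_classes P X Y. htpy_class Q U V (\<Phi> (SOME g. g \<in> C)))"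
  have B: "B (htpy_class P X Y g) = htpy_class Q U V (\<Phi> g)" if g: "g \<in> maps_with P X Y" for g
  proof -
    have "g \<in> htpy_class P X Y g"
      using g by (simp add: htpy_class_def htpy_rel_def maps_with_def)
    then have "(g, SOME f. f \<in> htpy_class P X Y g) \<in> htpy_rel P X Y"
      using someI[of "\<lambda>f. f \<in> htpy_class P X Y g" g] by (simp add: htpy_class_def)
    then show ?thesis
      using g class_eq by (simp add: B_def htpy_classes_def htpy_class_def quotientI)
  qed
  show ?thesis
    unfolding induces_on_htpy_classes_def
  proof (intro conjI ex1I ballI)
    show "\<Phi> \<in> maps_with P X Y \<rightarrow> maps_with Q U V"
      using maps by blast
    have "B C \<in> htpy_classes Q U V" if C: "C \<in> htpy_classes P X Y" for C
    proof -
      obtain g where "g \<in> maps_with P X Y" "C = htpy_class P X Y g"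
        using C unfolding htpy_classes_def htpy_class_def by (rule quotientE)
      then show ?thesis
        using maps[of g] by (simp add: B) (simp add: htpy_classes_def htpy_class_def quotientI)
    qed
    then show "B \<in> htpy_classes P X Y \<rightarrow>\<^sub>E htpy_classes Q U V"
      unfolding B_def by auto
    show "B (htpy_class P X Y g) = htpy_class Q U V (\<Phi> g)" if "g \<in> maps_with P X Y" for g
      using that by (rule B)
    fix B'
    assume B': "B' \<in> htpy_classes P X Y \<rightarrow>\<^sub>E htpy_classes Q U V \<and>
      (\<forall>g\<in>maps_with P X Y. B' (htpy_class P X Y g) = htpy_class Q U V (\<Phi> g))"
    show "B' = B"
    proof (rule extensionalityI)
      show "B' \<in> extensional (htpy_classes P X Y)"
        using B' by (simp add: PiE_def)
      show "B \<in> extensional (htpy_classes P X Y)"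
        by (simp add: B_def)
      fix C assume "C \<in> htpy_classes P X Y"
      then obtain g where "g \<in> maps_with P X Y" "C = htpy_class P X Y g"
        unfolding htpy_classes_def htpy_class_def by (rule quotientE)
      then show "B' C = B C"
        using B B' by simp
    qed
  qed
qed

context clifford_setting
begin

text \<open>\<open>P\<close> and \<open>Q\<close> stay open so that the based and the equivariant
  case share one argument: \<open>bott_map\<close> is applied to each stage of the homotopy.\<close>

lemma homotopic_with_bott_map:
  assumes PQ: "\<And>g. g \<in> topspace M \<rightarrow> topspace (C_s h s j) \<Longrightarrow> P g \<Longrightarrow> Q (bott_map h g)"
    and fg: "homotopic_with P M (C_s h s j) f g"
  shows "homotopic_with Q (susp M) (C_s1 h s j) (bott_map h f) (bott_map h g)"
proof -
  let ?I = "top_of_set {0..1::real}"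
  obtain H where H: "continuous_map (prod_topology ?I M) (C_s h s j) H"
    and H01: "\<And>x. H (0, x) = f x" "\<And>x. H (1, x) = g x"
    and P: "\<And>u. u \<in> {0..1} \<Longrightarrow> P (\<lambda>x. H (u, x))"
    using fg unfolding homotopic_with_def by blast
  have H_in: "H (u, k) \<in> topspace (C_s h s j)" if "u \<in> {0..1}" "k \<in> topspace M" for u k
    using continuous_map_image_subset_topspace[OF H] that by auto
  define G where "G = (\<lambda>(u, c). bott_map h (\<lambda>k. H (u, k)) c)"
  show ?thesis
    unfolding homotopic_with_def
  proof (intro exI conjI allI ballI)
    show "G (0, c) = bott_map h f c" "G (1, c) = bott_map h g c" for c
      by (simp_all add: G_def H01)
    show "Q (\<lambda>c. G (u, c))" if "u \<in> {0..1}" for u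
      using PQ[of "\<lambda>k. H (u, k)"] P[OF that] H_in[OF that] by (simp add: G_def Pi_iff)
    let ?X = "prod_topology ?I (prod_topology M ?I)"
    let ?q = "\<lambda>(u, p). (u, (\<lambda>(k, t). susp_pt M k t) p)"
    \<comment> \<open>The interval is locally compact Hausdorff, so its product with a quotient map
      is a quotient map, and continuity of \<open>G\<close> may be tested before collapsing.\<close>
    have "quotient_map ?X (prod_topology ?I (susp M)) ?q"
      by (intro quotient_map_prod_right quotient_map_susp_pt compact_imp_locally_compact_space disjI1)
        (simp_all add: compact_space_subtopology Hausdorff_space_subtopology)
    moreover have "continuous_map ?X (C_s1 h s j) (G \<circ> ?q)"
    proof (rule continuous_map_eq)
      have "continuous_map ?X (prod_topology ?I M) (\<lambda>x. (fst x, fst (snd x)))"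
        by (intro continuous_map_pairedI continuous_map_fst
            continuous_map_compose[OF continuous_map_snd continuous_map_fst, unfolded o_def])
      then have "continuous_map ?X (C_s h s j) (\<lambda>x. H (fst x, fst (snd x)))"
        using continuous_map_compose[OF _ H] by (simp add: o_def)
      moreover have "continuous_map ?X ?I (\<lambda>x. snd (snd x))"
        by (intro continuous_map_compose[OF continuous_map_snd continuous_map_snd, unfolded o_def])
      then have "continuous_map ?X euclideanreal (\<lambda>x. snd (snd x))"
        by (rule continuous_map_into_fulltopology)
      ultimately show "continuous_map ?X (C_s1 h s j)
          (\<lambda>x. beta h (snd (snd x)) (dbl_sub h (H (fst x, fst (snd x)))))"
        by (rule continuous_map_beta)
      show "beta h (snd (snd x)) (dbl_sub h (H (fst x, fst (snd x)))) = (G \<circ> ?q) x"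
        if "x \<in> topspace ?X" for x
        using that H_in by (auto simp: G_def bott_map_susp_pt)
    qed
    ultimately show "continuous_map (prod_topology ?I (susp M)) (C_s1 h s j) G"
      by (rule continuous_compose_quotient_map)
  qed
qed

end

theorem proposition5p1:
  fixes h b :: "complex ^ 'm::finite \<Rightarrow> complex ^ 'm \<Rightarrow> complex"
    and \<gamma> :: "complex ^ 'm \<Rightarrow> complex ^ 'm"
    and n s :: nat
    and j :: "nat \<Rightarrow> complex ^ 'm \<Rightarrow> complex ^ 'm"
    and M :: "'k topology" and \<tau> :: "'k \<Rightarrow> 'k" and k0 :: 'k
    and a0 :: "(complex ^ 'm) set" and A0 :: "((complex ^ 'm) \<times> (complex ^ 'm)) set"
  assumes "CARD('m) = 2 * n"
    and "clifford_setting h b \<gamma> s j"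
    and "continuous_map M M \<tau>" and "\<And>k. k \<in> topspace M \<Longrightarrow> \<tau> (\<tau> k) = k"
    and "k0 \<in> topspace M" and "\<tau> k0 = k0"
    and "A0 \<in> R_s1_1 h b s j" and "a0 \<in> R_s h b s j" and "A0 = dbl_sub h a0"
  shows
    "(\<forall>g \<in> maps_with (based k0 a0) M (C_s h s j). \<forall>k\<in>topspace M. \<forall>t\<in>{0..1}.
        bott_map h g (susp_pt M k t) = beta h t (dbl_sub h (g k))) \<and>
     induces_on_htpy_classes (bott_map h)
       (based k0 a0) M (C_s h s j)
       (based (susp_pt M k0 (1/2)) A0) (susp M) (C_s1 h s j) \<and>
     induces_on_htpy_classes (bott_map h)
       (based_equivariant M \<tau> k0 (annih b) a0) M (C_s h s j)
       (based_equivariant (susp M) (susp_inv \<tau>) (susp_pt M k0 (1/2)) (annih (dform b)) A0)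
       (susp M) (C_s1 h s j)"
proof (intro conjI ballI)
  interpret clifford_setting h b \<gamma> s j
    by fact
  have \<tau>: "\<tau> \<in> topspace M \<rightarrow> topspace M"
    using assms(3) by (rule continuous_map_funspace)
  have sub: "vec.subspace a0"
    using assms(8) by (simp add: R_s_def subspace_Cspace)
  have base: "bott_map h g (susp_pt M k0 (1/2)) = A0"
    if "g \<in> topspace M \<rightarrow> topspace (C_s h s j)" "g k0 = a0" for g
    using bott_map_susp_pt[of M g k0 "1/2"] that assms(5,9) sub by (auto simp: beta_half)
  show "bott_map h g (susp_pt M k t) = beta h t (dbl_sub h (g k))"
    if "g \<in> maps_with (based k0 a0) M (C_s h s j)" "k \<in> topspace M" "t \<in> {0..1}" for g k t
    using that continuous_map_funspace[of M "C_s h s j" g]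
    by (intro bott_map_susp_pt) (auto simp: maps_with_def)
  show "induces_on_htpy_classes (bott_map h) (based k0 a0) M (C_s h s j)
      (based (susp_pt M k0 (1/2)) A0) (susp M) (C_s1 h s j)"
    using base
    by (intro induces_on_htpy_classesI homotopic_with_bott_map) (auto simp: based_def)
  show "induces_on_htpy_classes (bott_map h)
      (based_equivariant M \<tau> k0 (annih b) a0) M (C_s h s j)
      (based_equivariant (susp M) (susp_inv \<tau>) (susp_pt M k0 (1/2)) (annih (dform b)) A0)
      (susp M) (C_s1 h s j)"
  proof (rule induces_on_htpy_classesI, erule homotopic_with_bott_map[rotated])
    fix g
    assume g: "g \<in> topspace M \<rightarrow> topspace (C_s h s j)"
      and P: "based_equivariant M \<tau> k0 (annih b) a0 g"
    show "based_equivariant (susp M) (susp_inv \<tau>) (susp_pt M k0 (1/2)) (annih (dform b)) A0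
        (bott_map h g)"
      unfolding based_equivariant_def
    proof (intro conjI ballI)
      show "bott_map h g (susp_pt M k0 (1/2)) = A0"
        using g P by (intro base) (auto simp: based_equivariant_def)
      fix c assume "c \<in> topspace (susp M)"
      then obtain k t where kt: "k \<in> topspace M" "t \<in> {0..1}" and c: "c = susp_pt M k t"
        by (rule susp_cases)
      have kt': "\<tau> k \<in> topspace M" "1 - t \<in> {0..1}"
        using \<tau> kt by auto
      have g_in: "g k \<in> topspace (C_s h s j)" if "k \<in> topspace M" for k
        using g that by blast
      have inv: "susp_inv \<tau> c = susp_pt M (\<tau> k) (1 - t)"
        unfolding c using \<tau> assms(4) kt by (rule susp_inv_susp_pt)
      have "bott_map h g (susp_inv \<tau> c) = beta h (1 - t) (dbl_sub h (g (\<tau> k)))"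
        unfolding inv using g_in kt' by (rule bott_map_susp_pt)
      \<comment> \<open>Equivariance of \<open>g\<close> supplies the annihilator of
        \<open>g k\<close>, and \<open>annih_beta\<close> absorbs the reversal of the
        parameter.\<close>
      also have "g (\<tau> k) = annih b (g k)"
        using P kt(1) by (simp add: based_equivariant_def)
      also have "beta h (1 - t) (dbl_sub h \<dots>) = annih (dform b) (beta h t (dbl_sub h (g k)))"
        using subspace_Cspace[OF g_in[OF kt(1)]] by (simp add: annih_beta)
      also have "beta h t (dbl_sub h (g k)) = bott_map h g c"
        unfolding c using g_in kt by (rule bott_map_susp_pt[symmetric])
      finally show "bott_map h g (susp_inv \<tau> c) = annih (dform b) (bott_map h g c)" .
    qed
  qed
qed

end
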